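(* Let $d\ge 1$. For every instance $\mathcal{R}$ of the MinUsageTime Dynamic Vector Bin Packing problem in $d$ dimensions, the Move To Front algorithm satisfies \[\mathsf{cost}(\mathrm{MF},\mathcal{R}) \le \big((2\mu+1)d+1\big)\cdot \mathsf{OPT}(\mathcal{R}),\] where $\mu$ is the ratio of the maximum to the minimum item duration in $\mathcal{R}$. That is, the competitive ratio of Move To Front is at most $(2\mu+1)d+1$.
   Context: MinUsageTime Dynamic Vector Bin Packing (non-clairvoyant, online, no repacking): an instance is a finite list $\mathcal{R}$ of items; each item $r$ has arrival time $a(r)\ge 0$, departure time $e(r)>a(r)$, and size $\mathbf{s}(r)\in[0,1]^d$. Its active interval is $I(r)=[a(r),e(r))$ with duration $\ell(I(r))=e(r)-a(r)$; $\mu=\max_r \ell(I(r))/\min_r \ell(I(r))$. Bins have capacity $1$ in each of the $d$ coordinates. Items are revealed in order of arrival (ties in a given order); on arrival, an item must be irrevocably placed into a bin such that the total size of items currently active in that bin stays $\le 1$ in every coordinate; the departure time is unknown at arrival. A bin is open while it contains an active item; once all its items have departed it is closed and never used again. If bin $B_i$ receives item set $R_i$, the cost of algorithm $\mathcal{A}$ is $\mathsf{cost}(\mathcal{A},\mathcal{R})=\sum_i \mathrm{span}(R_i)$, where $\mathrm{span}(S)$ is the Lebesgue measure of $\bigcup_{r\in S} I(r)$. $\mathsf{OPT}(\mathcal{R})=\int \mathsf{OPT}(\mathcal{R},t)\,dt$, where $\mathsf{OPT}(\mathcal{R},t)$ is the minimum number of unit-capacity bins into which the items active at time $t$ can be packed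 (offline, repacking allowed). Move To Front: maintains the list of open bins ordered by most recent use; an arriving item is placed into the first bin in the list that can accommodate it, and if none can, a new bin is opened; the bin receiving the item is then moved to the front of the list. *)

theory Defs
  imports "HOL-Analysis.Analysis" "HOL-Library.Multiset"
begin

record ('d :: finite) item =
  arrival :: real
  departure :: real
  demand :: "real ^ 'd"

definition active_interval :: "('d :: finite) item \<Rightarrow> real set" where
  "active_interval r = {arrival r..<departure r}"

definition duration :: "('d :: finite) item \<Rightarrow> real" where
  "duration r = departure r - arrival r"

(* Instances are lists, so that several items may have identical data; the order of the
   list matters only for items arriving at the same time. *)
definition valid_instance :: "('d :: finite) item list \<Rightarrow> bool" where
  "valid_instance R \<longleftrightarrow> (\<forall>r \<in> set R. 0 \<le> arrival r \<and> arrival r < departure r \<and>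
     (\<forall>k. 0 \<le> demand r $ k \<and> demand r $ k \<le> 1))"

definition duration_ratio :: "('d :: finite) item list \<Rightarrow> real" where
  "duration_ratio R = Max (duration ` set R) / Min (duration ` set R)"

definition active_items :: "real \<Rightarrow> ('d :: finite) item list \<Rightarrow> 'd item list" where
  "active_items t S = filter (\<lambda>r. t \<in> active_interval r) S"

definition within_capacity :: "('d :: finite) item list \<Rightarrow> bool" where
  "within_capacity S \<longleftrightarrow> (\<forall>k. (\<Sum>r\<leftarrow>S. demand r $ k) \<le> 1)"

definition span_time :: "('d :: finite) item list \<Rightarrow> real" where
  "span_time S = measure lborel (\<Union>r \<in> set S. active_interval r)"

definition OPT_at :: "('d :: finite) item list \<Rightarrow> real \<Rightarrow> nat" where
  "OPT_at R t = (LEAST n. \<exists>bins :: 'd item list list. length bins = n \<and>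
     mset (concat bins) = mset (active_items t R) \<and> (\<forall>B \<in> set bins. within_capacity B))"

definition OPT :: "('d :: finite) item list \<Rightarrow> real" where
  "OPT R = (\<integral>t. real (OPT_at R t) \<partial>lborel)"

(* A bin is the list of all items it has received so far, including departed ones. *)
type_synonym 'd bin = "'d item list"

definition open_at :: "real \<Rightarrow> ('d :: finite) bin \<Rightarrow> bool" where
  "open_at t B \<longleftrightarrow> active_items t B \<noteq> []"

definition accommodates :: "('d :: finite) item \<Rightarrow> 'd bin \<Rightarrow> bool" where
  "accommodates r B \<longleftrightarrow> within_capacity (r # active_items (arrival r) B)"

(* List.extract P xs splits xs at its first element satisfying P. *)
definition MF_place :: "('d :: finite) item \<Rightarrow> 'd bin list \<Rightarrow> 'd bin list" where
  "MF_place r bins = (case List.extract (accommodates r) bins of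
       None \<Rightarrow> [r] # bins
     | Some (before, B, after) \<Rightarrow> (r # B) # before @ after)"

(* A state consists of the bins not yet closed, most recently used first, and the closed
   bins. Bins that have become empty since the previous arrival are closed before the new
   item is placed; a closed bin is kept only for the computation of the cost. *)
definition MF_step ::
    "('d :: finite) item \<Rightarrow> 'd bin list \<times> 'd bin list \<Rightarrow> 'd bin list \<times> 'd bin list" where
  "MF_step r = (\<lambda>(opens, closeds).
     (MF_place r (filter (open_at (arrival r)) opens),
      filter (\<lambda>B. \<not> open_at (arrival r) B) opens @ closeds))"

(* sort_key is stable: items with the same arrival time are revealed in list order. *)
definition MF_bins :: "('d :: finite) item list \<Rightarrow> 'd bin list" where
  "MF_bins R = (case fold MF_step (sort_key arrival R) ([], []) of
     (opens, closeds) \<Rightarrow> opens @ closeds)"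

definition MF_cost :: "('d :: finite) item list \<Rightarrow> real" where
  "MF_cost R = (\<Sum>B\<leftarrow>MF_bins R. span_time B)"

end

theory Submission imports Defs begin

text \<open>
  Call the most recently used bin the leader. Cut the usage period of every bin at the moments
  when it receives an item and at the moments when it stops being the leader. The periods between
  an arrival and the next one, spent by the receiving bin as leader, are disjoint, so that they
  contribute at most the span of the instance, which is at most \<open>OPT\<close>. A bin stops being the leader
  while open only when an arriving item does not fit into it; the weights (sums of the coordinates
  of the demands) of that item and of the items active in the bin then add up to at least 1, and
  the period until the bin is used again or closes is at most the maximal duration \<open>M\<close>. Distribute
  the length of this period over these items in proportion to their weights. An item is charged at
  most once, hence at most \<open>M\<close>, for displacing a leader; for being active in a displaced bin it is
  charged disjoint periods that start while it is active, hence at most its duration plus \<open>M\<close>. The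
  weighted durations add up to at most \<open>d\<close> times \<open>OPT\<close>.
\<close>

section \<open>The optimum\<close>

text \<open>For nonnegative demands this is the l1 norm. It replaces vectors by scalars: a bin
  within capacity weighs at most \<open>CARD('d)\<close>, while one violated coordinate forces a
  weight above 1.\<close>

definition weight :: "('d :: finite) item \<Rightarrow> real" where
  "weight r = (\<Sum>k\<in>UNIV. demand r $ k)"

lemma weight_nonneg: "valid_instance R \<Longrightarrow> r \<in> set R \<Longrightarrow> 0 \<le> weight r"
  by (auto simp: weight_def valid_instance_def intro: sum_nonneg)

lemma sum_list_filter_indicator:
  fixes f :: "'a \<Rightarrow> real"
  shows "(\<Sum>r\<leftarrow>filter (\<lambda>r. t \<in> I r) R. f r) = (\<Sum>r\<leftarrow>R. f r * indicator (I r) t)"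
  by (induction R) auto

lemma sum_list_mset_cong:
  fixes f :: "'a \<Rightarrow> real"
  shows "mset A = mset B \<Longrightarrow> (\<Sum>r\<leftarrow>A. f r) = (\<Sum>r\<leftarrow>B. f r)"
  by (metis mset_map sum_mset_sum_list)

lemma sum_list_weight:
  fixes S :: "('d :: finite) item list"
  shows "(\<Sum>r\<leftarrow>S. weight r) = (\<Sum>k\<in>UNIV. \<Sum>r\<leftarrow>S. demand r $ k)"
  by (induction S) (auto simp: weight_def sum.distrib)

text \<open>Every demand is at most 1 in each coordinate, so each active item can have a bin of its
  own. Hence the \<open>LEAST\<close> in \<open>OPT_at\<close> is attained.\<close>

lemma singletons_packing:
  assumes "valid_instance R"
  shows "\<exists>bins. length bins = length (active_items t R) \<and>
    mset (concat bins) = mset (active_items t R) \<and> (\<forall>B \<in> set bins. within_capacity B)"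
proof (intro exI conjI)
  show "mset (concat (map (\<lambda>r. [r]) (active_items t R))) = mset (active_items t R)"
    by simp
  show "\<forall>B\<in>set (map (\<lambda>r. [r]) (active_items t R)). within_capacity B"
    using assms by (auto simp: within_capacity_def valid_instance_def active_items_def)
qed simp

lemma OPT_at_attained:
  assumes "valid_instance R"
  obtains bins where "length bins = OPT_at R t"
    "mset (concat bins) = mset (active_items t R)" "\<forall>B \<in> set bins. within_capacity B"
  using LeastI[where P = "\<lambda>n. \<exists>bins. length bins = n \<and>
    mset (concat bins) = mset (active_items t R) \<and> (\<forall>B \<in> set bins. within_capacity B)",
    OF singletons_packing[OF assms]]
  unfolding OPT_at_def by blast

lemma OPT_at_le_length: "valid_instance R \<Longrightarrow> OPT_at R t \<le> length (active_items t R)"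
  unfolding OPT_at_def by (rule Least_le) (rule singletons_packing)

lemma OPT_at_le_active:
  assumes "valid_instance R"
  shows "real (OPT_at R t) \<le> (\<Sum>r\<leftarrow>R. indicator (active_interval r) t)"
proof -
  have "OPT_at R t \<le> length (active_items t R)"
    using assms by (rule OPT_at_le_length)
  moreover have "real (length (active_items t R)) = (\<Sum>r\<leftarrow>R. indicator (active_interval r) t)"
    using sum_list_filter_indicator[where t = t and I = active_interval and f = "\<lambda>_. 1" and R = R]
    by (simp add: active_items_def sum_list_triv)
  ultimately show ?thesis by linarith
qed

text \<open>Adding the capacity constraints of all coordinates shows that each bin of an optimal
  packing weighs at most \<open>CARD('d)\<close>.\<close>

lemma weight_le_OPT_at:
  fixes R :: "('d :: finite) item list"
  assumes "valid_instance R"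
  shows "(\<Sum>r\<leftarrow>R. weight r * indicator (active_interval r) t) \<le> real CARD('d) * real (OPT_at R t)"
proof -
  obtain bins where b: "length bins = OPT_at R t"
    "mset (concat bins) = mset (active_items t R)" "\<forall>B \<in> set bins. within_capacity B"
    by (rule OPT_at_attained[OF assms])
  have "(\<Sum>r\<leftarrow>R. weight r * indicator (active_interval r) t) = (\<Sum>r\<leftarrow>active_items t R. weight r)"
    unfolding active_items_def by (rule sum_list_filter_indicator[symmetric])
  also have "\<dots> = (\<Sum>r\<leftarrow>concat bins. weight r)"
    using b(2) by (intro sum_list_mset_cong) simp
  also have "\<dots> = (\<Sum>B\<leftarrow>bins. \<Sum>r\<leftarrow>B. weight r)"
    by (induction bins) auto
  also have "\<dots> \<le> (\<Sum>B\<leftarrow>bins. real CARD('d))"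
  proof (rule sum_list_mono)
    fix B assume "B \<in> set bins"
    then have "(\<Sum>r\<leftarrow>B. weight r) \<le> (\<Sum>k\<in>(UNIV::'d set). 1)"
      unfolding sum_list_weight using b(3) by (intro sum_mono) (auto simp: within_capacity_def)
    then show "(\<Sum>r\<leftarrow>B. weight r) \<le> real CARD('d)" by simp
  qed
  also have "\<dots> = real CARD('d) * real (OPT_at R t)"
    by (simp add: sum_list_triv b(1))
  finally show ?thesis .
qed

lemma indicator_le_OPT_at:
  assumes "valid_instance R"
  shows "indicator (\<Union>r\<in>set R. active_interval r) t \<le> real (OPT_at R t)"
proof (cases "t \<in> (\<Union>r\<in>set R. active_interval r)")
  case True
  obtain bins where b: "length bins = OPT_at R t"
    "mset (concat bins) = mset (active_items t R)"
    by (rule OPT_at_attained[OF assms])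
  from True have "active_items t R \<noteq> []"
    by (auto simp: active_items_def filter_empty_conv)
  with b(2) have "bins \<noteq> []" by auto
  with b(1) have "1 \<le> OPT_at R t" by (cases bins) auto
  then show ?thesis by (simp add: indicator_def)
qed auto

text \<open>\<open>OPT_at\<close> depends on time only through the list of active items. This list
  is measurable into a discrete space, and every function on a discrete space is measurable.\<close>

lemma measurable_OPT_at: "(\<lambda>t. real (OPT_at R t)) \<in> borel_measurable lborel"
proof -
  have "(\<lambda>t. active_items t R) \<in> measurable lborel (count_space UNIV)"
  proof (induction R)
    case Nil
    then show ?case by (simp add: active_items_def)
  next
    case (Cons r R)
    have "(\<lambda>t. if t \<in> active_interval r then r # active_items t R else active_items t R)
        \<in> measurable lborel (count_space UNIV)"
      using Cons by (intro measurable_If measurable_compose[OF Cons])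
        (auto simp: active_interval_def)
    then show ?case
      by (rule back_subst[where P = "\<lambda>f. f \<in> _"]) (auto simp: active_items_def)
  qed
  from measurable_compose[OF this, where g = "\<lambda>S. real (LEAST n. \<exists>bins. length bins = n \<and>
     mset (concat bins) = mset S \<and> (\<forall>B \<in> set bins. within_capacity B))" and L = borel]
  show ?thesis by (simp add: OPT_at_def)
qed

section \<open>Integrating the pointwise bounds over time\<close>

lemma has_bochner_integral_sum_list:
  fixes f :: "'b \<Rightarrow> 'a \<Rightarrow> real"
  assumes "\<And>r. r \<in> set R \<Longrightarrow> has_bochner_integral M (f r) (c r)"
  shows "has_bochner_integral M (\<lambda>t. \<Sum>r\<leftarrow>R. f r t) (\<Sum>r\<leftarrow>R. c r)"
  using assms by (induction R) (auto intro: has_bochner_integral_add)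

lemma has_bochner_integral_active:
  assumes "valid_instance R" "r \<in> set R"
  shows "has_bochner_integral lborel (\<lambda>t. c * indicator (active_interval r) t) (c * duration r)"
proof -
  have "arrival r \<le> departure r"
    using assms by (auto simp: valid_instance_def)
  then have "has_bochner_integral lborel (indicator (active_interval r)) (duration r :: real)"
    using has_bochner_integral_real_indicator[of "active_interval r" lborel]
    by (simp add: active_interval_def duration_def)
  then show ?thesis by (rule has_bochner_integral_mult_right)
qed

lemma integrable_OPT_at:
  assumes "valid_instance R"
  shows "integrable lborel (\<lambda>t. real (OPT_at R t))"
proof (rule Bochner_Integration.integrable_bound)
  show "integrable lborel (\<lambda>t. \<Sum>r\<leftarrow>R. 1 * indicator (active_interval r) t :: real)"
    using has_bochner_integral_sum_list[OF has_bochner_integral_active[OF assms, of _ 1], of R]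
    by (simp add: has_bochner_integral_iff)
  show "AE t in lborel. norm (real (OPT_at R t))
      \<le> norm (\<Sum>r\<leftarrow>R. 1 * indicator (active_interval r) t :: real)"
    using OPT_at_le_active[OF assms] by (intro always_eventually allI) (simp add: order_trans[OF _ abs_ge_self])
qed (rule measurable_OPT_at)

lemma weighted_duration_le_OPT:
  fixes R :: "('d :: finite) item list"
  assumes "valid_instance R"
  shows "(\<Sum>r\<leftarrow>R. weight r * duration r) \<le> real CARD('d) * OPT R"
proof -
  have w: "has_bochner_integral lborel (\<lambda>t. \<Sum>r\<leftarrow>R. weight r * indicator (active_interval r) t)
      (\<Sum>r\<leftarrow>R. weight r * duration r)"
    by (intro has_bochner_integral_sum_list has_bochner_integral_active[OF assms])
  then have "(\<Sum>r\<leftarrow>R. weight r * duration r)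
      = (\<integral>t. (\<Sum>r\<leftarrow>R. weight r * indicator (active_interval r) t) \<partial>lborel)"
    by (simp add: has_bochner_integral_iff)
  also have "\<dots> \<le> (\<integral>t. real CARD('d) * real (OPT_at R t) \<partial>lborel)"
    using w integrable_OPT_at[OF assms] weight_le_OPT_at[OF assms]
    by (intro integral_mono) (auto simp: has_bochner_integral_iff)
  also have "\<dots> = real CARD('d) * OPT R"
    by (simp add: OPT_def)
  finally show ?thesis .
qed

lemma fmeasurable_Ico: "{a..<b::real} \<in> fmeasurable lborel"
  by (cases "a \<le> b") (auto simp: fmeasurable_def)

definition busy :: "('d :: finite) item list \<Rightarrow> real set" where
  "busy S = (\<Union>r \<in> set S. active_interval r)"

lemma fmeasurable_busy: "busy S \<in> fmeasurable lborel"
  unfolding busy_def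
  by (intro fmeasurable.finite_UN) (auto simp: active_interval_def fmeasurable_Ico)

lemma sets_busy [simp]: "busy S \<in> sets borel"
  using fmeasurable_busy[of S] by (simp add: fmeasurable_def)

lemma span_time_le_OPT:
  assumes "valid_instance R"
  shows "span_time R \<le> OPT R"
proof -
  have "integrable lborel (indicator (busy R) :: real \<Rightarrow> real)"
    using fmeasurable_busy[of R] by (auto simp: fmeasurable_def intro!: integrable_real_indicator)
  then have "(\<integral>t. indicator (busy R) t \<partial>lborel) \<le> OPT R"
    unfolding OPT_def using integrable_OPT_at[OF assms] indicator_le_OPT_at[OF assms]
    by (intro integral_mono) (auto simp: busy_def)
  then show ?thesis by (simp add: span_time_def busy_def)
qed

section \<open>Amortized cost of a bin\<close>

text \<open>For a nonempty bin, the time at which it closes if it receives nothing more.\<close>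

definition bin_end :: "('d :: finite) bin \<Rightarrow> real" where
  "bin_end B = Max (departure ` set B)"

definition short_item :: "real \<Rightarrow> ('d :: finite) item \<Rightarrow> bool" where
  "short_item M r \<longleftrightarrow> 0 \<le> weight r \<and> arrival r < departure r \<and> duration r \<le> M"

section \<open>Closing time and span of a bin\<close>

lemma bin_end_attained:
  assumes "B \<noteq> []" obtains r where "r \<in> set B" "bin_end B = departure r"
proof -
  have "Max (departure ` set B) \<in> departure ` set B"
    using assms by (intro Max_in) auto
  with that show thesis by (auto simp: bin_end_def)
qed

lemma bin_end_Cons: "B \<noteq> [] \<Longrightarrow> bin_end (r # B) = max (departure r) (bin_end B)"
  by (simp add: bin_end_def)

lemma bin_end_le:
  assumes "B \<noteq> []" "\<forall>r\<in>set B. short_item M r \<and> arrival r \<le> a"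
  shows "bin_end B \<le> a + M"
  using bin_end_attained[OF assms(1)] assms(2)
  by (metis add_mono add.commute diff_add_cancel duration_def short_item_def)

lemma open_at_iff:
  assumes "B \<noteq> []" "\<forall>r\<in>set B. arrival r \<le> t"
  shows "open_at t B \<longleftrightarrow> t < bin_end B"
  using assms by (auto simp: open_at_def active_items_def filter_empty_conv active_interval_def
      bin_end_def Max_gr_iff)

lemma busy_initial:
  assumes "B \<noteq> []" "\<forall>r\<in>set B. arrival r \<le> a"
  shows "{a..<bin_end B} \<subseteq> busy B"
  using bin_end_attained[OF assms(1)] assms(2)
  by (fastforce simp: busy_def active_interval_def)

text \<open>The bin is open when \<open>r\<close> arrives, so the time from then until
  \<open>bin_end B\<close> is already counted in its span; only an extension beyond
  \<open>bin_end B\<close> is new.\<close>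

lemma span_time_Cons_le:
  assumes "B \<noteq> []" "\<forall>s\<in>set B. arrival s \<le> arrival r" "arrival r < bin_end B"
  shows "span_time (r # B) \<le> span_time B + (bin_end (r # B) - bin_end B)"
proof -
  let ?J = "{bin_end B..<bin_end (r # B)}"
  have "busy (r # B) \<subseteq> busy B \<union> ?J"
    using busy_initial[OF assms(1,2)] bin_end_Cons[OF assms(1), of r]
    by (auto simp: busy_def active_interval_def subset_iff)
  moreover have J: "?J \<in> fmeasurable lborel"
    by (rule fmeasurable_Ico)
  ultimately have "measure lborel (busy (r # B)) \<le> measure lborel (busy B \<union> ?J)"
    by (intro measure_mono_fmeasurable) (simp_all add: fmeasurable.Un fmeasurable_busy)
  also have "\<dots> \<le> measure lborel (busy B) + measure lborel ?J"
    using fmeasurable_busy[of B] J by (intro measure_Un_le) auto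
  finally show ?thesis
    using bin_end_Cons[OF assms(1), of r] by (simp add: span_time_def busy_def)
qed

text \<open>The total length of the displaced periods of its bin charged, up to time \<open>t\<close>, to an
  item: these periods lie after its arrival, and the last one ends at most \<open>M\<close> after its
  departure.\<close>

definition charged :: "real \<Rightarrow> real \<Rightarrow> ('d :: finite) item \<Rightarrow> real" where
  "charged M t r = (if t < departure r then t - arrival r else duration r + M)"

definition charges :: "real \<Rightarrow> real \<Rightarrow> ('d :: finite) bin \<Rightarrow> real" where
  "charges M t B = (\<Sum>r\<leftarrow>B. weight r * charged M t r)"

text \<open>The value of \<open>charges\<close> once all items have departed.\<close>

definition full_charges :: "real \<Rightarrow> ('d :: finite) bin \<Rightarrow> real" where
  "full_charges M B = (\<Sum>r\<leftarrow>B. weight r * (duration r + M))"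

definition active_weight :: "real \<Rightarrow> ('d :: finite) bin \<Rightarrow> real" where
  "active_weight t B = (\<Sum>r\<leftarrow>active_items t B. weight r)"

lemma active_weight_eq:
  "active_weight t B = (\<Sum>r\<leftarrow>B. weight r * indicator (active_interval r) t)"
  unfolding active_weight_def active_items_def by (rule sum_list_filter_indicator)

lemma charges_mono:
  assumes "\<forall>r\<in>set B. short_item M r" "s \<le> t"
  shows "charges M s B \<le> charges M t B"
  unfolding charges_def using assms
  by (intro sum_list_mono mult_left_mono) (auto simp: charged_def short_item_def duration_def)

lemma charges_le_full:
  assumes "\<forall>r\<in>set B. short_item M r"
  shows "charges M t B \<le> full_charges M B"
  unfolding charges_def full_charges_def using assms
  by (intro sum_list_mono mult_left_mono) (auto simp: charged_def short_item_def duration_def)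

text \<open>An item active at \<open>s\<close> that is still active at \<open>t\<close> is charged
  exactly \<open>t - s\<close> more. If it departs in between, its charge at \<open>s\<close> is
  below its duration and \<open>t - s\<close> is at most \<open>M\<close>, so the cap
  \<open>duration r + M\<close> suffices.\<close>

lemma charges_advance:
  assumes "\<forall>r\<in>set B. short_item M r \<and> arrival r \<le> s" "s \<le> t" "t \<le> s + M"
  shows "charges M s B + active_weight s B * (t - s) \<le> charges M t B"
proof -
  have "charges M s B + active_weight s B * (t - s)
      = (\<Sum>r\<leftarrow>B. weight r * (charged M s r + indicator (active_interval r) s * (t - s)))"
    unfolding charges_def active_weight_eq
    by (induction B) (auto simp: algebra_simps)
  also have "\<dots> \<le> charges M t B"
    unfolding charges_def using assms
    by (intro sum_list_mono mult_left_mono)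
      (auto simp: charged_def short_item_def duration_def active_interval_def indicator_def)
  finally show ?thesis .
qed

text \<open>The states of a bin at the last arrival time \<open>a\<close>. The credit \<open>c\<close> of the bin is the time it
  spent as leader up to \<open>a\<close> plus \<open>M\<close> times the weights of the items that displaced it; for a
  displaced bin, \<open>\<tau>\<close> is the time of the last displacement and \<open>v\<close> the weight of the item
  responsible, whose share is not spent yet.\<close>

definition leading :: "real \<Rightarrow> real \<Rightarrow> ('d :: finite) bin \<Rightarrow> real \<Rightarrow> bool" where
  "leading M a B c \<longleftrightarrow> B \<noteq> [] \<and> (\<forall>r\<in>set B. short_item M r \<and> arrival r \<le> a) \<and> a \<le> bin_end B \<and>
     span_time B \<le> c + (bin_end B - a) + charges M a B"

definition displaced :: "real \<Rightarrow> real \<Rightarrow> ('d :: finite) bin \<Rightarrow> real \<Rightarrow> bool" where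
  "displaced M a B c \<longleftrightarrow> B \<noteq> [] \<and> (\<exists>\<tau>\<le>a. \<exists>v\<ge>0. (\<forall>r\<in>set B. short_item M r \<and> arrival r \<le> \<tau>) \<and>
     1 \<le> v + active_weight \<tau> B \<and>
     span_time B \<le> c - M * v + (bin_end B - \<tau>) + charges M \<tau> B)"

definition settled :: "real \<Rightarrow> ('d :: finite) bin \<Rightarrow> real \<Rightarrow> bool" where
  "settled M B c \<longleftrightarrow> span_time B \<le> c + full_charges M B"

section \<open>Transitions between the states of a bin\<close>

lemma leading_singleton:
  assumes "short_item M r"
  shows "leading M (arrival r) [r] 0"
  using assms
  by (auto simp: leading_def bin_end_def span_time_def active_interval_def charges_def
      charged_def short_item_def)

text \<open>The time led since \<open>a\<close> moves from the remaining period
  \<open>bin_end B - a\<close> into the credit.\<close>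

lemma leading_receive:
  assumes "leading M a B c" "short_item M r" "a \<le> arrival r" "arrival r < bin_end B"
  shows "leading M (arrival r) (r # B) (c + (arrival r - a))"
proof -
  have "span_time (r # B) \<le> span_time B + (bin_end (r # B) - bin_end B)"
    using assms by (intro span_time_Cons_le) (auto simp: leading_def)
  moreover have "charges M a B \<le> charges M (arrival r) B"
    using assms by (intro charges_mono) (auto simp: leading_def)
  \<comment> \<open>The new item starts with charge 0, being active with
    \<open>t - arrival r = 0\<close>.\<close>
  moreover have "charges M (arrival r) (r # B) = charges M (arrival r) B"
    using assms(2) by (simp add: charges_def charged_def short_item_def)
  ultimately show ?thesis
    using assms by (fastforce simp: leading_def bin_end_Cons)
qed

lemma sum_list_coordinate_le_weight:
  assumes "\<forall>r\<in>set S. \<forall>k. 0 \<le> demand r $ k"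
  shows "(\<Sum>r\<leftarrow>S. demand r $ k) \<le> (\<Sum>r\<leftarrow>S. weight r)"
  unfolding weight_def using assms by (intro sum_list_mono member_le_sum) auto

text \<open>The coordinate in which \<open>r\<close> does not fit gives total weight above 1. The
  credit grows by the time led and by \<open>M * weight r\<close>; the latter is the reserve
  \<open>M * v\<close> that \<open>displaced\<close> holds back, with
  \<open>v = weight r\<close>.\<close>

lemma leading_displace:
  assumes "leading M a B c" "short_item M r" "a \<le> arrival r" "\<not> accommodates r B"
    "\<forall>s\<in>set (r # B). \<forall>k. 0 \<le> demand s $ k"
  shows "displaced M (arrival r) B (c + (arrival r - a) + M * weight r)"
proof -
  obtain k where "1 < (\<Sum>s\<leftarrow>r # active_items (arrival r) B. demand s $ k)"
    using assms(4) by (auto simp: accommodates_def within_capacity_def not_le)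
  also have "\<dots> \<le> (\<Sum>s\<leftarrow>r # active_items (arrival r) B. weight s)"
    using assms(5) by (intro sum_list_coordinate_le_weight) (auto simp: active_items_def)
  finally have "1 \<le> weight r + active_weight (arrival r) B"
    by (simp add: active_weight_def)
  moreover have "charges M a B \<le> charges M (arrival r) B"
    using assms by (intro charges_mono) (auto simp: leading_def)
  moreover have "B \<noteq> []" "\<forall>s\<in>set B. short_item M s \<and> arrival s \<le> arrival r"
    "span_time B \<le> c + (bin_end B - a) + charges M a B" "0 \<le> weight r"
    using assms(1-3) by (auto simp: leading_def short_item_def)
  ultimately show ?thesis
    unfolding displaced_def
    by (intro conjI exI[of _ "arrival r"] exI[of _ "weight r"]) auto
qed

text \<open>Without further arrivals the bin leads until it closes, so the remaining period becomes
  credit.\<close>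

lemma leading_settle: "leading M a B c \<Longrightarrow> settled M B (c + (bin_end B - a))"
  using charges_le_full[of B M a] by (auto simp: leading_def settled_def)

lemma displaced_later: "displaced M a B c \<Longrightarrow> a \<le> b \<Longrightarrow> displaced M b B c"
  unfolding displaced_def by (meson order_trans)

text \<open>Pays for the displaced period from \<open>\<tau>\<close> to \<open>t\<close>: the
  reserve \<open>M * v\<close> covers the share of the displacing item, and the charges cover the
  shares of the items active at \<open>\<tau>\<close>.\<close>

lemma displaced_advance:
  assumes "displaced M a B c" "a \<le> t" "t \<le> bin_end B"
  shows "span_time B \<le> c + (bin_end B - t) + charges M t B"
proof -
  obtain \<tau> v where *: "\<tau> \<le> a" "v \<ge> 0" "\<forall>r\<in>set B. short_item M r \<and> arrival r \<le> \<tau>"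
    "1 \<le> v + active_weight \<tau> B"
    "span_time B \<le> c - M * v + (bin_end B - \<tau>) + charges M \<tau> B" "B \<noteq> []"
    using assms(1) by (auto simp: displaced_def)
  \<comment> \<open>All items of the bin arrived by \<open>\<tau>\<close>, so the bin closes by
    \<open>\<tau> + M\<close>.\<close>
  have t: "\<tau> \<le> t" "t - \<tau> \<le> M"
    using bin_end_le[OF *(6,3)] * assms by auto
  have "t - \<tau> \<le> (v + active_weight \<tau> B) * (t - \<tau>)"
    using t *(4) mult_right_mono[of 1 "v + active_weight \<tau> B" "t - \<tau>"] by simp
  also have "\<dots> \<le> v * M + active_weight \<tau> B * (t - \<tau>)"
    using t *(2) by (simp add: distrib_right mult_left_mono)
  finally show ?thesis
    using charges_advance[OF *(3), of t] t *(5) by (simp add: mult.commute)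
qed

lemma displaced_receive:
  assumes "displaced M a B c" "short_item M r" "a \<le> arrival r" "arrival r < bin_end B"
  shows "leading M (arrival r) (r # B) c"
proof -
  have B: "B \<noteq> []" "\<forall>s\<in>set B. short_item M s \<and> arrival s \<le> arrival r"
    using assms by (force simp: displaced_def)+
  have "span_time (r # B) \<le> span_time B + (bin_end (r # B) - bin_end B)"
    using assms B by (intro span_time_Cons_le) auto
  moreover have "span_time B \<le> c + (bin_end B - arrival r) + charges M (arrival r) B"
    using assms by (intro displaced_advance) auto
  moreover have "charges M (arrival r) (r # B) = charges M (arrival r) B"
    using assms(2) by (simp add: charges_def charged_def short_item_def)
  ultimately show ?thesis
    using assms B by (auto simp: leading_def bin_end_Cons)
qed

lemma displaced_settle:
  assumes "displaced M a B c" shows "settled M B c"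
proof -
  obtain \<tau> v where *: "\<tau> \<le> a" "v \<ge> 0" "\<forall>r\<in>set B. short_item M r \<and> arrival r \<le> \<tau>"
    "1 \<le> v + active_weight \<tau> B"
    "span_time B \<le> c - M * v + (bin_end B - \<tau>) + charges M \<tau> B" "B \<noteq> []"
    using assms by (auto simp: displaced_def)
  have full: "charges M t B \<le> full_charges M B" for t
    using charges_le_full * by blast
  show ?thesis
  proof (cases "\<tau> \<le> bin_end B")
    case True
    \<comment> \<open>The bin may have closed before \<open>a\<close>, so the state is moved back to
      \<open>\<tau>\<close>.\<close>
    have "displaced M \<tau> B c"
      using * by (auto simp: displaced_def)
    from displaced_advance[OF this True] show ?thesis
      using full[of "bin_end B"] by (auto simp: settled_def)
  next
    case False
    have "0 \<le> M"
      using *(3,6) by (cases B) (auto simp: short_item_def duration_def)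
    then have "0 \<le> M * v" using *(2) by simp
    with False *(5) full[of \<tau>] show ?thesis by (auto simp: settled_def)
  qed
qed

section \<open>The run of Move To Front\<close>

text \<open>Credits are not determined by the bins, and equal bins may occur repeatedly; hence a
  list of credits matched by position, of which only the sum stays visible.\<close>

definition total_credit :: "(('d :: finite) bin \<Rightarrow> real \<Rightarrow> bool) \<Rightarrow> 'd bin list \<Rightarrow> real \<Rightarrow> bool" where
  "total_credit P Bs C \<longleftrightarrow> (\<exists>cs. list_all2 P Bs cs \<and> C = sum_list cs)"

lemma total_credit_Nil [simp]: "total_credit P [] C \<longleftrightarrow> C = 0"
  by (auto simp: total_credit_def)

lemma total_credit_Cons:
  "total_credit P (B # Bs) C \<longleftrightarrow> (\<exists>c D. P B c \<and> total_credit P Bs D \<and> C = c + D)"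
  by (force simp: total_credit_def list_all2_Cons1)

lemma total_credit_ConsI:
  "P B c \<Longrightarrow> total_credit P Bs D \<Longrightarrow> total_credit P (B # Bs) (c + D)"
  by (auto simp: total_credit_Cons)

lemma total_credit_append:
  "total_credit P (As @ Bs) C \<longleftrightarrow> (\<exists>A B. total_credit P As A \<and> total_credit P Bs B \<and> C = A + B)"
proof (induction As arbitrary: C)
  case (Cons X Xs)
  show ?case
  proof
    assume "total_credit P ((X # Xs) @ Bs) C"
    then obtain c A B where "P X c" "total_credit P Xs A" "total_credit P Bs B" "C = (c + A) + B"
      by (auto simp: total_credit_Cons Cons)
    moreover from this have "total_credit P (X # Xs) (c + A)"
      by (auto simp: total_credit_Cons)
    ultimately show "\<exists>A B. total_credit P (X # Xs) A \<and> total_credit P Bs B \<and> C = A + B"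
      by blast
  next
    assume "\<exists>A B. total_credit P (X # Xs) A \<and> total_credit P Bs B \<and> C = A + B"
    then obtain c A B where "P X c" "total_credit P Xs A" "total_credit P Bs B" "C = c + (A + B)"
      by (auto simp: total_credit_Cons)
    moreover from this have "total_credit P (Xs @ Bs) (A + B)"
      by (auto simp: Cons)
    ultimately show "total_credit P ((X # Xs) @ Bs) C"
      by (auto simp: total_credit_Cons)
  qed
qed simp

lemma total_credit_filter:
  "total_credit P Bs C \<Longrightarrow>
    \<exists>A B. total_credit P (filter Q Bs) A \<and> total_credit P (filter (\<lambda>X. \<not> Q X) Bs) B \<and> C = A + B"
proof (induction Bs arbitrary: C)
  case (Cons X Xs)
  then obtain c D where c: "P X c" "total_credit P Xs D" "C = c + D"
    by (auto simp: total_credit_Cons)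
  obtain A B where "total_credit P (filter Q Xs) A"
    "total_credit P (filter (\<lambda>X. \<not> Q X) Xs) B" "D = A + B"
    using Cons.IH[OF c(2)] by blast
  note AB = this
  show ?case
  proof (cases "Q X")
    case True
    then have "total_credit P (filter Q (X # Xs)) (c + A)"
      "total_credit P (filter (\<lambda>X. \<not> Q X) (X # Xs)) B" "C = (c + A) + B"
      using c AB by (auto simp: total_credit_Cons)
    then show ?thesis by blast
  next
    case False
    then have "total_credit P (filter Q (X # Xs)) A"
      "total_credit P (filter (\<lambda>X. \<not> Q X) (X # Xs)) (c + B)" "C = A + (c + B)"
      using c AB by (auto simp: total_credit_Cons)
    then show ?thesis by blast
  qed
qed simp

lemma total_credit_mono:
  assumes "total_credit P Bs C" "\<And>B c. B \<in> set Bs \<Longrightarrow> P B c \<Longrightarrow> Q B c"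
  shows "total_credit Q Bs C"
proof -
  obtain cs where cs: "list_all2 P Bs cs" "C = sum_list cs"
    using assms(1) by (auto simp: total_credit_def)
  from cs(1) have "list_all2 Q Bs cs"
    by (rule list.rel_mono_strong) (rule assms(2))
  with cs(2) show ?thesis by (auto simp: total_credit_def)
qed

lemma total_credit_member: "total_credit P Bs C \<Longrightarrow> B \<in> set Bs \<Longrightarrow> \<exists>c. P B c"
  by (induction Bs arbitrary: C) (auto simp: total_credit_Cons)

lemma total_credit_settled:
  "total_credit (settled M) Bs C \<Longrightarrow>
    (\<Sum>B\<leftarrow>Bs. span_time B) \<le> C + full_charges M (concat Bs)"
  by (induction Bs arbitrary: C) (fastforce simp: total_credit_Cons settled_def full_charges_def)+

text \<open>The budget for leader time up to \<open>t\<close>: leader periods are disjoint and some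
  item is active throughout them.\<close>

definition busy_before :: "real \<Rightarrow> ('d :: finite) item list \<Rightarrow> real" where
  "busy_before t S = measure lborel (busy S \<inter> {..<t})"

lemma fmeasurable_busy_before: "busy S \<inter> {..<t} \<in> fmeasurable lborel"
  by (rule fmeasurable_Int_fmeasurable[OF fmeasurable_busy]) auto

lemma busy_before_le_span: "busy_before t S \<le> span_time S"
  unfolding busy_before_def span_time_def busy_def[symmetric]
  by (rule measure_mono_fmeasurable) (use fmeasurable_busy fmeasurable_busy_before in auto)

lemma busy_before_Cons: "busy_before t S \<le> busy_before t (r # S)"
  unfolding busy_before_def
  by (rule measure_mono_fmeasurable)
    (use fmeasurable_busy_before[of S t] fmeasurable_busy_before[of "r # S" t] in \<open>auto simp: busy_def\<close>)

lemma busy_before_advance: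
  assumes "{a..<b} \<subseteq> busy S" "a \<le> b" "b \<le> t"
  shows "busy_before a S + (b - a) \<le> busy_before t S"
proof -
  have "busy_before a S + (b - a) = measure lborel ((busy S \<inter> {..<a}) \<union> {a..<b})"
  proof -
    have "busy S \<inter> {..<a} \<inter> {a..<b} = {}" by auto
    then show ?thesis
      using measure_Un3[OF fmeasurable_busy_before[of S a] fmeasurable_Ico[of a b]] assms(2)
      by (simp add: busy_before_def)
  qed
  also have "\<dots> \<le> busy_before t S"
    unfolding busy_before_def
    by (rule measure_mono_fmeasurable)
      (use assms fmeasurable_busy_before[of S t] fmeasurable_busy_before[of S a] in auto)
  finally show ?thesis .
qed

text \<open>The latest arrival, at time \<open>a\<close>, put its bin in front, so the first bin
  leads and all other open ones have been displaced. Credits are paid by busy time and by one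
  payment of \<open>M * weight r\<close> per item, since an arrival displaces at most one leader.
  The multiset equation later turns charges summed over bins into charges summed over the
  instance.\<close>

definition run_invariant ::
    "real \<Rightarrow> real \<Rightarrow> ('d :: finite) item list \<Rightarrow> 'd bin list \<times> 'd bin list \<Rightarrow> bool" where
  "run_invariant M a S = (\<lambda>(opens, closeds). \<exists>F Bs c C D. opens = F # Bs \<and>
     mset (concat (opens @ closeds)) = mset S \<and> leading M a F c \<and>
     total_credit (displaced M a) Bs C \<and> total_credit (settled M) closeds D \<and>
     c + C + D \<le> busy_before a S + M * (\<Sum>r\<leftarrow>S. weight r))"

section \<open>One arrival\<close>

lemma mset_MF_place: "mset (concat (MF_place r bins)) = add_mset r (mset (concat bins))"
  by (auto simp: MF_place_def extract_Some_iff split: option.splits)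

lemma mset_concat_filter:
  "mset (concat (filter Q Bs)) + mset (concat (filter (\<lambda>B. \<not> Q B) Bs)) = mset (concat Bs)"
  by (induction Bs) (auto simp: ac_simps)

text \<open>A new bin starts with credit 0, and a displaced bin that is used again keeps its credit;
  either way the total is unchanged.\<close>

lemma place_displaced:
  assumes "short_item M r" "total_credit (displaced M (arrival r)) Bs C"
    "\<forall>B\<in>set Bs. arrival r < bin_end B"
  shows "\<exists>F Bs' c C'. MF_place r Bs = F # Bs' \<and> leading M (arrival r) F c \<and>
    total_credit (displaced M (arrival r)) Bs' C' \<and> c + C' = C"
proof (cases "List.extract (accommodates r) Bs")
  case None
  then show ?thesis
    using leading_singleton[OF assms(1)] assms(2) by (auto simp: MF_place_def)
next
  case (Some x)
  then obtain ys B zs where x: "x = (ys, B, zs)" "Bs = ys @ B # zs"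
    by (cases x) (auto simp: extract_Some_iff)
  then obtain A b D where A: "total_credit (displaced M (arrival r)) ys A"
    "displaced M (arrival r) B b" "total_credit (displaced M (arrival r)) zs D" "C = A + (b + D)"
    using assms(2) by (auto simp: total_credit_append total_credit_Cons)
  have "leading M (arrival r) (r # B) b"
    using displaced_receive[OF A(2) assms(1)] assms(3) x by auto
  moreover have "total_credit (displaced M (arrival r)) (ys @ zs) (A + D)"
    using A by (auto simp: total_credit_append)
  ultimately show ?thesis
    using Some x A(4) by (intro exI) (auto simp: MF_place_def)
qed

lemma run_invariant_step:
  assumes inv: "run_invariant M a S st" and r: "short_item M r" "a \<le> arrival r"
    and nonneg: "\<forall>s\<in>set (r # S). \<forall>k. 0 \<le> demand s $ k"
  shows "run_invariant M (arrival r) (r # S) (MF_step r st)"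
proof -
  let ?t = "arrival r"
  let ?Q = "open_at ?t"
  obtain opens closeds where st': "st = (opens, closeds)" by (cases st)
  obtain F Bs c C D where opens: "opens = F # Bs"
    and ms: "mset (concat (opens @ closeds)) = mset S" and F: "leading M a F c"
    and C: "total_credit (displaced M a) Bs C" and D: "total_credit (settled M) closeds D"
    and le: "c + C + D \<le> busy_before a S + M * (\<Sum>r\<leftarrow>S. weight r)"
    using inv unfolding st' run_invariant_def prod.case by blast
  note st = st'[unfolded opens] and ms = ms[unfolded opens]
  define O' where "O' = filter ?Q (F # Bs)"
  define K where "K = filter (\<lambda>B. \<not> ?Q B) (F # Bs)"
  have step: "MF_step r st = (MF_place r O', K @ closeds)"
    by (simp add: st MF_step_def O'_def K_def)
  have "mset (concat O') + mset (concat K) = mset (concat (F # Bs))"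
    unfolding O'_def K_def by (rule mset_concat_filter)
  then have "mset S = mset (concat O') + mset (concat K) + mset (concat closeds)"
    using ms by (simp flip: add.assoc)
  then have ms': "mset (concat (MF_place r O' @ K @ closeds)) = mset (r # S)"
    using mset_MF_place[of r O'] by simp
  have F': "F \<noteq> []" "\<forall>s\<in>set F. short_item M s \<and> arrival s \<le> a" "a \<le> bin_end F"
    using F by (auto simp: leading_def)
  have openF: "?Q F \<longleftrightarrow> ?t < bin_end F"
    using F' r(2) by (intro open_at_iff) force+
  have "set F \<subseteq> set S"
    using arg_cong[OF ms, of set_mset] by auto
  then have busyF: "{a..<bin_end F} \<subseteq> busy S"
    using busy_initial[OF F'(1), of a] F'(2) by (fastforce simp: busy_def)
  have "0 \<le> M" "0 \<le> weight r"
    using r by (auto simp: short_item_def duration_def)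
  then have Mw: "0 \<le> M * weight r" by simp
  have Bs_end: "?t < bin_end B" if B: "B \<in> set Bs" "?Q B" for B
  proof -
    obtain b where "displaced M a B b"
      using total_credit_member[OF C B(1)] by blast
    then have "B \<noteq> []" "\<forall>s\<in>set B. arrival s \<le> ?t"
      using r(2) by (force simp: displaced_def)+
    then show ?thesis using B(2) open_at_iff by blast
  qed
  have later: "total_credit (displaced M ?t) Bs C"
    by (rule total_credit_mono[OF C]) (rule displaced_later[OF _ r(2)])
  obtain C1 C2 where C1: "total_credit (displaced M ?t) (filter ?Q Bs) C1"
    and "total_credit (displaced M ?t) (filter (\<lambda>B. \<not> ?Q B) Bs) C2" and C12: "C = C1 + C2"
    using total_credit_filter[OF later, where Q = ?Q] by blast
  then have C2: "total_credit (settled M) (filter (\<lambda>B. \<not> ?Q B) Bs) C2"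
    by (elim total_credit_mono) (rule displaced_settle)
  \<comment> \<open>The old leader led from \<open>a\<close> until this arrival or its own closing,
    whichever came first. The term \<open>M * weight r\<close> is spent only if the leader is open
    and rejects \<open>r\<close>.\<close>
  have "\<exists>F' Bs' c' C' D'. MF_place r O' = F' # Bs' \<and> leading M ?t F' c' \<and>
     total_credit (displaced M ?t) Bs' C' \<and> total_credit (settled M) K D' \<and>
     c' + C' + D' \<le> c + C + (min ?t (bin_end F) - a) + M * weight r"
  proof (cases "?Q F \<and> accommodates r F")
    case True
    then have "MF_place r O' = (r # F) # filter ?Q Bs"
      by (simp add: MF_place_def O'_def extract_Cons_code)
    moreover have "leading M ?t (r # F) (c + (?t - a))"
      using leading_receive[OF F r] True openF by simp
    ultimately show ?thesis
      using True C1 C2 C12 openF Mw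
      by (intro exI[of _ "r # F"] exI[of _ "filter ?Q Bs"] exI[of _ "c + (?t - a)"]
          exI[of _ C1] exI[of _ C2]) (auto simp: K_def min_def)
  next
    case False
    \<comment> \<open>The old leader is now displaced or settled, so every bin in \<open>O'\<close>
      is displaced and \<open>place_displaced\<close> applies.\<close>
    have "\<exists>C' D'. total_credit (displaced M ?t) O' C' \<and> total_credit (settled M) K D' \<and>
        C' + D' \<le> c + C + (min ?t (bin_end F) - a) + M * weight r"
    proof (cases "?Q F")
      case True
      have "displaced M ?t F (c + (?t - a) + M * weight r)"
        using leading_displace[OF F r] False True nonneg \<open>set F \<subseteq> set S\<close> by auto
      then have "total_credit (displaced M ?t) O' (c + (?t - a) + M * weight r + C1)"
        using True C1 by (auto simp: O'_def total_credit_Cons)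
      then show ?thesis
        using True C2 C12 openF by (intro exI conjI) (auto simp: K_def)
    next
      case False
      have "settled M F (c + (bin_end F - a))"
        using F by (rule leading_settle)
      then have "total_credit (settled M) K (c + (bin_end F - a) + C2)"
        using False C2 by (auto simp: K_def total_credit_Cons)
      then show ?thesis
        using False C1 C12 openF Mw
        by (intro exI[of _ C1] exI[of _ "c + (bin_end F - a) + C2"]) (auto simp: O'_def)
    qed
    then obtain C' D' where CD: "total_credit (displaced M ?t) O' C'"
      "total_credit (settled M) K D'"
      "C' + D' \<le> c + C + (min ?t (bin_end F) - a) + M * weight r" by blast
    have "\<forall>B\<in>set O'. ?t < bin_end B"
      using Bs_end openF by (auto simp: O'_def)
    from place_displaced[OF r(1) CD(1) this] CD(2,3) show ?thesis by fastforce
  qed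
  then obtain F' Bs' c' C' D' where new: "MF_place r O' = F' # Bs'" "leading M ?t F' c'"
     "total_credit (displaced M ?t) Bs' C'" "total_credit (settled M) K D'"
     "c' + C' + D' \<le> c + C + (min ?t (bin_end F) - a) + M * weight r" by blast
  \<comment> \<open>The new leader period starts at \<open>a\<close>, after all busy time counted so
    far.\<close>
  have "busy_before a S + (min ?t (bin_end F) - a) \<le> busy_before ?t S"
    using busyF F'(3) r(2) by (intro busy_before_advance) auto
  also have "\<dots> \<le> busy_before ?t (r # S)"
    by (rule busy_before_Cons)
  finally have "c' + C' + (D' + D) \<le> busy_before ?t (r # S) + M * (\<Sum>s\<leftarrow>r # S. weight s)"
    using le new(5) by (simp add: distrib_left)
  moreover have "total_credit (settled M) (K @ closeds) (D' + D)"
    using new(4) D by (auto simp: total_credit_append)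
  ultimately show ?thesis
    unfolding run_invariant_def step using new ms' by blast
qed

lemma run_invariant_fold:
  assumes "xs \<noteq> []" "sorted (map arrival xs)" "\<forall>r\<in>set xs. short_item M r"
    "\<forall>s\<in>set xs. \<forall>k. 0 \<le> demand s $ k"
  shows "run_invariant M (arrival (last xs)) (rev xs) (fold MF_step xs ([], []))"
  using assms
proof (induction xs rule: rev_nonempty_induct)
  case (single r)
  then have "leading M (arrival r) [r] 0" "0 \<le> M * weight r"
    by (auto intro!: leading_singleton mult_nonneg_nonneg simp: short_item_def duration_def)
  moreover have "fold MF_step [r] ([], []) = ([[r]], [])"
    by (simp add: MF_step_def MF_place_def List.extract_def)
  ultimately show ?case
    unfolding run_invariant_def
    by (intro case_prodI2 exI[of _ "[r]"] exI[of _ "[]"] exI[of _ 0])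
      (auto simp: busy_before_def)
next
  case (snoc r xs)
  have "arrival (last xs) \<le> arrival r"
    using snoc by (simp add: sorted_append)
  then show ?case
    using snoc run_invariant_step[of M "arrival (last xs)" "rev xs" _ r]
    by (simp add: sorted_append)
qed

text \<open>After the last arrival the leader leads until it closes and all other bins settle. Of
  the term \<open>2 * M\<close>, one \<open>M\<close> pays for displacing a leader and the other for
  charges that run on after departure.\<close>

lemma MF_cost_le:
  fixes R :: "('d :: finite) item list"
  assumes "valid_instance R" "\<forall>r\<in>set R. duration r \<le> M"
  shows "MF_cost R \<le> span_time R + (\<Sum>r\<leftarrow>R. weight r * (duration r + 2 * M))"
proof (cases "R = []")
  case True
  then show ?thesis by (simp add: MF_cost_def MF_bins_def span_time_def)
next
  case False
  define xs where "xs = sort_key arrival R"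
  have xs: "mset xs = mset R" "sorted (map arrival xs)" by (simp_all add: xs_def)
  then have set: "set xs = set R" by (metis set_mset_mset)
  then have "xs \<noteq> []" using False by auto
  moreover have "\<forall>r\<in>set xs. short_item M r"
    using assms weight_nonneg[OF assms(1)] by (simp add: set short_item_def valid_instance_def)
  moreover have "\<forall>s\<in>set xs. \<forall>k. 0 \<le> demand s $ k"
    using assms by (auto simp: set valid_instance_def)
  ultimately have inv: "run_invariant M (arrival (last xs)) (rev xs) (fold MF_step xs ([], []))"
    using xs by (intro run_invariant_fold)
  let ?a = "arrival (last xs)"
  obtain opens closeds where st: "fold MF_step xs ([], []) = (opens, closeds)"
    by (cases "fold MF_step xs ([], [])")
  obtain F Bs c C D where opens: "opens = F # Bs"
    and ms: "mset (concat (opens @ closeds)) = mset (rev xs)" and F: "leading M ?a F c"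
    and C: "total_credit (displaced M ?a) Bs C" and D: "total_credit (settled M) closeds D"
    and le: "c + C + D \<le> busy_before ?a (rev xs) + M * (\<Sum>r\<leftarrow>rev xs. weight r)"
    using inv unfolding st run_invariant_def prod.case by blast
  note ms = ms[unfolded opens]
  have bins: "MF_bins R = F # Bs @ closeds"
    using st opens by (simp add: MF_bins_def xs_def)
  have "total_credit (settled M) Bs C"
    by (rule total_credit_mono[OF C]) (rule displaced_settle)
  with D have "total_credit (settled M) (Bs @ closeds) (C + D)"
    by (auto simp: total_credit_append)
  then have "total_credit (settled M) (MF_bins R) ((c + (bin_end F - ?a)) + (C + D))"
    unfolding bins by (rule total_credit_ConsI[where P = "settled M", OF leading_settle[OF F]])
  then have "MF_cost R \<le> (c + (bin_end F - ?a)) + (C + D) + full_charges M (concat (MF_bins R))"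
    unfolding MF_cost_def by (rule total_credit_settled)
  moreover have "full_charges M (concat (MF_bins R)) = full_charges M R"
    unfolding full_charges_def using ms xs by (intro sum_list_mset_cong) (simp add: bins)
  moreover have "(\<Sum>r\<leftarrow>rev xs. weight r) = (\<Sum>r\<leftarrow>R. weight r)"
    using xs by (intro sum_list_mset_cong) simp
  moreover have "busy_before ?a (rev xs) + (bin_end F - ?a) \<le> span_time R"
  proof -
    have "set F \<subseteq> set (rev xs)"
      using arg_cong[OF ms, of set_mset] by auto
    then have "{?a..<bin_end F} \<subseteq> busy (rev xs)"
      using busy_initial[of F ?a] F by (fastforce simp: busy_def leading_def)
    then have "busy_before ?a (rev xs) + (bin_end F - ?a) \<le> busy_before (bin_end F) (rev xs)"
      using F by (intro busy_before_advance) (auto simp: leading_def)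
    also have "\<dots> \<le> span_time R"
      using busy_before_le_span[of "bin_end F" "rev xs"] by (simp add: span_time_def set)
    finally show ?thesis .
  qed
  moreover have "M * (\<Sum>r\<leftarrow>R. weight r) + full_charges M R
      = (\<Sum>r\<leftarrow>R. weight r * (duration r + 2 * M))"
    unfolding full_charges_def by (induction R) (auto simp: algebra_simps)
  ultimately show ?thesis
    using le by simp
qed

theorem theorem1:
  fixes R :: "('d :: finite) item list"
  assumes "valid_instance R"
  shows "MF_cost R \<le> ((2 * duration_ratio R + 1) * real CARD('d) + 1) * OPT R"
proof (cases "R = []")
  \<comment> \<open>For the empty instance \<open>duration_ratio\<close> is a quotient of
    unspecified values, but the cost and \<open>OPT\<close> are both 0.\<close>
  case True
  then show ?thesis
    using span_time_le_OPT[OF assms] weighted_duration_le_OPT[OF assms]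
    by (simp add: MF_cost_def MF_bins_def OPT_def OPT_at_def active_items_def Least_eq_0)
next
  case False
  define M where "M = Max (duration ` set R)"
  let ?\<mu> = "duration_ratio R"
  have M: "\<forall>r\<in>set R. duration r \<le> M" by (simp add: M_def)
  have pos: "0 < Min (duration ` set R)"
    using False assms by (auto simp: valid_instance_def duration_def)
  have "M > 0"
    using False M assms by (cases R) (auto simp: valid_instance_def duration_def)
  then have \<mu>: "0 \<le> ?\<mu>"
    using pos by (simp add: duration_ratio_def M_def)
  \<comment> \<open>Turns \<open>duration r + 2 * M\<close> into at most
    \<open>2 * ?\<mu> + 1\<close> times the duration, so that the weighted durations can be compared
    with \<open>OPT\<close>.\<close>
  have M_le: "M \<le> ?\<mu> * duration r" if "r \<in> set R" for r
  proof -
    have "M = ?\<mu> * Min (duration ` set R)"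
      using pos by (simp add: duration_ratio_def M_def)
    also have "\<dots> \<le> ?\<mu> * duration r"
      using that \<mu> by (intro mult_left_mono) auto
    finally show ?thesis .
  qed
  have "MF_cost R \<le> span_time R + (\<Sum>r\<leftarrow>R. weight r * (duration r + 2 * M))"
    using assms M by (rule MF_cost_le)
  also have "(\<Sum>r\<leftarrow>R. weight r * (duration r + 2 * M))
      \<le> (\<Sum>r\<leftarrow>R. (2 * ?\<mu> + 1) * (weight r * duration r))"
  proof (rule sum_list_mono)
    fix r assume "r \<in> set R"
    then have "weight r * (duration r + 2 * M) \<le> weight r * ((2 * ?\<mu> + 1) * duration r)"
      using M_le[of r] weight_nonneg[OF assms]
      by (intro mult_left_mono) (auto simp: algebra_simps)
    then show "weight r * (duration r + 2 * M) \<le> (2 * ?\<mu> + 1) * (weight r * duration r)"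
      by (simp add: ac_simps)
  qed
  also have "\<dots> = (2 * ?\<mu> + 1) * (\<Sum>r\<leftarrow>R. weight r * duration r)"
    by (rule sum_list_const_mult)
  also have "\<dots> \<le> (2 * ?\<mu> + 1) * (real CARD('d) * OPT R)"
    using weighted_duration_le_OPT[OF assms] \<mu> by (intro mult_left_mono) auto
  also have "span_time R \<le> OPT R" by (rule span_time_le_OPT[OF assms])
  finally show ?thesis by (simp add: algebra_simps)
qed

end
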